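(* Let $\gamma$ be the Gauss measure on $\mathbb{R}^n$. The inclusion $H^1(\gamma)\subset \mathfrak{h}^1(\gamma)$ is strict.
   Context: $\gamma$ is the probability measure on $\mathbb{R}^n$ with density $x\mapsto \pi^{-n/2}e^{-|x|^2}$ with respect to Lebesgue measure. Balls are Euclidean balls; $c_B$ and $r_B$ denote the centre and radius of a ball $B$. $\|\cdot\|_2$ is the norm of $L^2(\gamma)$. A ball $B$ is admissible if $r_B\le \min(1,1/|c_B|)$ (with $1/0=\infty$). An $H^1(\gamma)$-atom is either the constant function $1$ or a function $a\in L^1(\gamma)$ supported in an admissible ball $B$ with $\|a\|_2\le \gamma(B)^{-1/2}$ and $\int a\,d\gamma=0$. The space $H^1(\gamma)$ is the set of all $f\in L^1(\gamma)$ of the form $f=\sum_j\lambda_j a_j$ with $a_j$ $H^1(\gamma)$-atoms and $\sum_j|\lambda_j|<\infty$, normed by the infimum of $\sum_j|\lambda_j|$ over all such representations. A global atom is a function $a\in L^2(\gamma)$ with support contained in a ball $B$ of radius exactly $\min(1,1/|c_B|)$ such that $\|a\|_2\le\gamma(B)^{-1/2}$ (no cancellation is required). An $\mathfrak{h}^1(\gamma)$-atom is either an $H^1(\gamma)$-atom or a global atom. The space $\mathfrak{h}^1(\gamma)$ is the set of all $f=\sum_j\lambda_j a_j$ with $a_j$ $\mathfrak{h}^1(\gamma)$-atoms and $\sum_j|\lambda_j|<\infty$, normed by the infimum of $\sum_j|\lambda_j|$ over all such decompositions. *)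

theory Defs
  imports "HOL-Analysis.Analysis"
begin

definition gauss :: "(real ^ 'n) measure" where
  "gauss = density lborel
     (\<lambda>x. ennreal (pi powr (- real CARD('n) / 2) * exp (- (norm x)\<^sup>2)))"

text \<open>
  Elements of \<open>L\<^sup>1\<close> and \<open>L\<^sup>2\<close> are represented by measurable functions, not by classes modulo
  almost everywhere equality. The sets \<open>H1_gauss\<close> and \<open>h1_gauss\<close> below are closed under
  almost everywhere equality, so strict inclusion between them is the same as
  strict inclusion between the corresponding sets of classes.
  The scalar type \<open>'k\<close> can be \<^typ>\<open>real\<close> or \<^typ>\<open>complex\<close>.
\<close>

definition L1_gauss ::
  "(real ^ 'n \<Rightarrow> 'k::{real_normed_field, banach, second_countable_topology}) set" where
  "L1_gauss = {f. integrable gauss f}"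

definition L2_gauss ::
  "(real ^ 'n \<Rightarrow> 'k::{real_normed_field, banach, second_countable_topology}) set" where
  "L2_gauss = {f \<in> borel_measurable gauss. integrable gauss (\<lambda>x. (norm (f x))\<^sup>2)}"

definition L2_norm_gauss ::
  "(real ^ 'n \<Rightarrow> 'k::{real_normed_field, banach, second_countable_topology}) \<Rightarrow> real" where
  "L2_norm_gauss f = sqrt (\<integral>x. (norm (f x))\<^sup>2 \<partial>gauss)"

text \<open>
  This is \<open>min(1, 1/|c|)\<close> with the convention \<open>1/0 = \<infinity>\<close>; the case distinction is needed
  because division by zero yields zero in HOL.
\<close>

definition admissible_radius :: "real ^ 'n \<Rightarrow> real" where
  "admissible_radius c = (if c = 0 then 1 else min 1 (1 / norm c))"

text \<open>
  Support is understood modulo null sets. Balls are taken closed, but spheres are null sets,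
  so open balls would give the same atoms.
\<close>

definition supported_in ::
  "(real ^ 'n \<Rightarrow> 'k::{real_normed_field, banach, second_countable_topology})
     \<Rightarrow> (real ^ 'n) set \<Rightarrow> bool" where
  "supported_in a B \<longleftrightarrow> (AE x in gauss. x \<notin> B \<longrightarrow> a x = 0)"

definition H1_atoms ::
  "(real ^ 'n \<Rightarrow> 'k::{real_normed_field, banach, second_countable_topology}) set" where
  "H1_atoms = {\<lambda>x. 1} \<union>
     {a \<in> L1_gauss \<inter> L2_gauss. \<exists>c r. 0 < r \<and> r \<le> admissible_radius c \<and>
        supported_in a (cball c r) \<and>
        L2_norm_gauss a \<le> measure gauss (cball c r) powr (- 1 / 2) \<and>
        (\<integral>x. a x \<partial>gauss) = 0}"

definition global_atoms ::
  "(real ^ 'n \<Rightarrow> 'k::{real_normed_field, banach, second_countable_topology}) set" where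
  "global_atoms = {a \<in> L2_gauss. \<exists>c.
     supported_in a (cball c (admissible_radius c)) \<and>
     L2_norm_gauss a \<le> measure gauss (cball c (admissible_radius c)) powr (- 1 / 2)}"

definition h1_atoms ::
  "(real ^ 'n \<Rightarrow> 'k::{real_normed_field, banach, second_countable_topology}) set" where
  "h1_atoms = H1_atoms \<union> global_atoms"

text \<open>
  All atoms have \<open>L\<^sup>1\<close> norm at most one, so a series of atoms with absolutely summable
  coefficients converges absolutely in \<open>L\<^sup>1\<close>; its sum is taken in that space.
  Finite sums are covered by zero coefficients.
\<close>

definition atomic_space ::
  "(real ^ 'n \<Rightarrow> 'k::{real_normed_field, banach, second_countable_topology}) set
     \<Rightarrow> (real ^ 'n \<Rightarrow> 'k) set" where
  "atomic_space A = {f \<in> L1_gauss. \<exists>(l :: nat \<Rightarrow> 'k) a.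
     (\<forall>j. a j \<in> A) \<and> summable (\<lambda>j. norm (l j)) \<and>
     (\<lambda>N. \<integral>x. norm (f x - (\<Sum>j<N. l j * a j x)) \<partial>gauss) \<longlonglongrightarrow> 0}"

definition H1_gauss ::
  "(real ^ 'n \<Rightarrow> 'k::{real_normed_field, banach, second_countable_topology}) set" where
  "H1_gauss = atomic_space H1_atoms"

definition h1_gauss ::
  "(real ^ 'n \<Rightarrow> 'k::{real_normed_field, banach, second_countable_topology}) set" where
  "h1_gauss = atomic_space h1_atoms"

end

theory Submission
  imports Defs "HOL-Probability.Distributions"
begin

text \<open>
  The function \<open>|x|\<^sup>2\<close> oscillates by at most \<open>3\<close> on every admissible ball, since
  \<open>|c + h|\<^sup>2 - |c|\<^sup>2 = 2 \<langle>c, h\<rangle> + |h|\<^sup>2\<close> and \<open>|c| |h| \<le> 1\<close>. The truncations \<open>min |x|\<^sup>2 M\<close> inherit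
  this bound, so pairing with them is bounded on \<open>H\<^sup>1\<close>-atoms uniformly in \<open>M\<close>, and hence on each
  element of \<open>H\<^sup>1\<close>. On the other hand \<open>\<Sum>j. 2\<^sup>-\<^sup>j 1\<^bsub>B(j)\<^esub> / \<gamma>(B(j))\<close>, with global balls \<open>B(j)\<close>
  on which \<open>|x| \<ge> 2\<^sup>j\<close>, is an element of \<open>\<hh>\<^sup>1\<close> whose pairings with the truncations are unbounded.
\<close>

section \<open>Finiteness, second moment and positivity on balls of the Gauss measure\<close>

lemma sets_gauss [simp, measurable_cong]: "sets (gauss :: (real^'n) measure) = sets borel"
  by (simp add: gauss_def)

text \<open>The integrand is a product of one-variable Gaussians over the coordinates, so Tonelli
  reduces the claim to the standard normal density. The factor 1/2 in the exponent keeps half of the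
  decay of exp(-|x|^2) in reserve for a polynomial weight.\<close>

lemma integrable_exp_neg_half_norm_sq:
  "integrable lborel (\<lambda>x::'a::euclidean_space. exp (- (norm x)\<^sup>2 / 2))"
proof (rule integrableI_nonneg)
  have one: "(\<integral>\<^sup>+t. ennreal (exp (- t\<^sup>2 / 2)) \<partial>lborel) < \<infinity>"
  proof -
    have "integrable lborel (\<lambda>t. sqrt (2 * pi) * std_normal_density t)"
      by (intro integrable_mult_right integrable_normal_density) simp
    then have "integrable lborel (\<lambda>t::real. exp (- t\<^sup>2 / 2))"
      by (simp add: std_normal_density_def)
    then show ?thesis
      by (simp add: integrable_iff_bounded)
  qed
  have "exp (- (norm x)\<^sup>2 / 2) = (\<Prod>b\<in>Basis. exp (- (x \<bullet> b)\<^sup>2 / 2))" for x :: 'a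
  proof -
    have "(norm x)\<^sup>2 = (\<Sum>b\<in>Basis. (x \<bullet> b)\<^sup>2)"
      by (metis (no_types, lifting) euclidean_inner power2_eq_square power2_norm_eq_inner sum.cong)
    then show ?thesis
      by (simp add: exp_sum [symmetric] sum_negf sum_divide_distrib)
  qed
  then have "(\<integral>\<^sup>+x. ennreal (exp (- (norm (x::'a))\<^sup>2 / 2)) \<partial>lborel)
      = (\<integral>\<^sup>+x. (\<Prod>b\<in>Basis. ennreal (exp (- ((x::'a) \<bullet> b)\<^sup>2 / 2))) \<partial>lborel)"
    by (simp add: prod_ennreal)
  also have "\<dots> = (\<Prod>b\<in>(Basis::'a set). \<integral>\<^sup>+t. ennreal (exp (- t\<^sup>2 / 2)) \<partial>lborel)"
    by (rule nn_integral_lborel_prod) auto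
  also have "\<dots> < \<infinity>"
    using one by (simp add: power_less_top_ennreal)
  finally show "(\<integral>\<^sup>+x. ennreal (exp (- (norm (x::'a))\<^sup>2 / 2)) \<partial>lborel) < \<infinity>" .
qed auto

text \<open>Both integrands are at most 2(1 + |x|^2/2), and 1 + t \<le> exp t bounds this by 2
  exp(|x|^2/2). Half of the Gaussian decay absorbs that growth, and the other half is
  integrable.\<close>

lemma integrable_gauss_norm_sq: "integrable gauss (\<lambda>x::real^'n. (norm x)\<^sup>2)"
  and integrable_gauss_one: "integrable gauss (\<lambda>x::real^'n. 1 :: real)"
proof -
  let ?C = "pi powr (- real CARD('n) / 2)"
  have *: "integrable gauss f"
    if [measurable]: "f \<in> borel_measurable borel"
      and bound: "\<And>x. \<bar>f x\<bar> \<le> 2 * (1 + (norm x)\<^sup>2 / 2)" for f :: "real^'n \<Rightarrow> real"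
    unfolding gauss_def
  proof (subst integrable_density)
    show "integrable lborel (\<lambda>x. (?C * exp (- (norm x)\<^sup>2)) *\<^sub>R f x)"
    proof (rule Bochner_Integration.integrable_bound)
      show "integrable lborel (\<lambda>x::real^'n. 2 * ?C * exp (- (norm x)\<^sup>2 / 2))"
        by (intro integrable_mult_right integrable_exp_neg_half_norm_sq)
      show "AE x in lborel. norm ((?C * exp (- (norm x)\<^sup>2)) *\<^sub>R f x)
          \<le> norm (2 * ?C * exp (- (norm x)\<^sup>2 / 2))"
      proof (rule AE_I2)
        fix x :: "real^'n"
        have "\<bar>f x\<bar> \<le> 2 * exp ((norm x)\<^sup>2 / 2)"
          using exp_ge_add_one_self [of "(norm x)\<^sup>2 / 2"]
          by (intro order_trans [OF bound] mult_left_mono) auto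
        then have "exp (- (norm x)\<^sup>2) * \<bar>f x\<bar>
            \<le> exp (- (norm x)\<^sup>2) * (2 * exp ((norm x)\<^sup>2 / 2))"
          by (intro mult_left_mono) auto
        also have "\<dots> = 2 * exp (- (norm x)\<^sup>2 / 2)"
          by (simp add: exp_add [symmetric])
        finally show "norm ((?C * exp (- (norm x)\<^sup>2)) *\<^sub>R f x)
            \<le> norm (2 * ?C * exp (- (norm x)\<^sup>2 / 2))"
          by (simp add: abs_mult mult.assoc mult.left_commute)
      qed
    qed simp
  qed auto
  show "integrable gauss (\<lambda>x::real^'n. (norm x)\<^sup>2)" "integrable gauss (\<lambda>x::real^'n. 1 :: real)"
    by (rule *; simp)+
qed

interpretation gauss: finite_measure "gauss :: (real^'n) measure"
proof
  show "emeasure (gauss :: (real^'n) measure) (space gauss) \<noteq> \<infinity>"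
    using integrable_gauss_one by (simp add: integrable_iff_bounded less_top)
qed

text \<open>The density is positive everywhere, so a null set of \<open>gauss\<close> is Lebesgue
  null, which a ball of positive radius is not. Divisions by the measure of a ball are legitimate
  for this reason.\<close>

lemma measure_gauss_cball_pos:
  assumes "0 < r"
  shows "0 < measure gauss (cball (c::real^'n) r)"
proof -
  have "cball c r \<notin> null_sets gauss"
  proof
    assume "cball c r \<in> null_sets gauss"
    then have "AE x in lborel. x \<notin> cball c r"
      unfolding gauss_def by (subst (asm) null_sets_density_iff) auto
    then have "emeasure lborel (cball c r) = 0"
      by (subst (asm) AE_iff_measurable [of "cball c r"]) auto
    then show False
      using content_cball_pos [OF assms, of c] by (simp add: measure_def)
  qed
  then show ?thesis
    by (simp add: null_sets_def gauss.emeasure_eq_measure zero_less_measure_iff)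
qed

section \<open>Admissible balls and the oscillation of |x|^2 on them\<close>

lemma admissible_radius_pos: "0 < admissible_radius c"
  and admissible_radius_le_one: "admissible_radius c \<le> 1"
  and norm_mult_admissible_radius_le: "norm c * admissible_radius c \<le> 1"
  by (auto simp: admissible_radius_def min_def field_simps)

text \<open>Factoring the difference of squares gives the bound h(2|c| + h) with h = |x - c|. Both
  parts of admissibility enter: |c| h \<le> 1 controls the first term by 2, and h \<le> 1 controls
  the second by 1.\<close>

lemma norm_sq_oscillation:
  assumes "r \<le> admissible_radius c" "x \<in> cball c r"
  shows "\<bar>(norm x)\<^sup>2 - (norm c)\<^sup>2\<bar> \<le> 3"
proof -
  define h where "h = norm (x - c)"
  have h: "0 \<le> h" "h \<le> admissible_radius c"
    using assms by (auto simp: h_def dist_norm norm_minus_commute)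
  then have h1: "h \<le> 1" and ch: "norm c * h \<le> 1"
    using admissible_radius_le_one [of c] norm_mult_admissible_radius_le [of c]
      mult_left_mono [of h "admissible_radius c" "norm c"] by auto
  have "\<bar>norm x - norm c\<bar> \<le> h"
    by (simp add: h_def norm_triangle_ineq3)
  moreover have "norm x + norm c \<le> 2 * norm c + h"
    using norm_triangle_ineq2 [of x c] by (simp add: h_def)
  ultimately have "\<bar>norm x - norm c\<bar> * (norm x + norm c) \<le> h * (2 * norm c + h)"
    by (intro mult_mono) (auto simp: h)
  also have "\<dots> \<le> 3"
    using ch mult_mono [OF h1 h1] h by (simp add: algebra_simps)
  also have "\<bar>norm x - norm c\<bar> * (norm x + norm c) = \<bar>(norm x)\<^sup>2 - (norm c)\<^sup>2\<bar>"
    by (simp add: power2_eq_square square_diff_square_factored abs_mult mult.commute)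
  finally show ?thesis .
qed

section \<open>Pairing atoms and atomic series with bounded functions\<close>

text \<open>In place of Cauchy-Schwarz, the proof integrates t \<le> m t^2/2 + 1/(2m) over the ball,
  with t = |a(x)| and m the measure of the ball. This weighting makes each of the two terms
  contribute at most 1/2.\<close>

lemma L1_norm_le_one:
  fixes a :: "real^'n \<Rightarrow> 'k::{real_normed_field, banach, second_countable_topology}"
  assumes "a \<in> L1_gauss" "a \<in> L2_gauss" "0 < r"
    and supp: "supported_in a (cball c r)"
    and L2: "L2_norm_gauss a \<le> measure gauss (cball c r) powr (- 1 / 2)"
  shows "(\<integral>x. norm (a x) \<partial>gauss) \<le> 1"
proof -
  define m where "m = measure gauss (cball c r)"
  have m: "0 < m"
    unfolding m_def by (rule measure_gauss_cball_pos) fact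
  have int: "integrable gauss a" "integrable gauss (\<lambda>x. (norm (a x))\<^sup>2)"
    using assms by (auto simp: L1_gauss_def L2_gauss_def)
  have "(L2_norm_gauss a)\<^sup>2 \<le> (m powr (- 1 / 2))\<^sup>2"
    using L2 by (intro power_mono) (auto simp: m_def L2_norm_gauss_def)
  also have "(m powr (- 1 / 2))\<^sup>2 = 1 / m"
    using m by (simp add: power2_eq_square powr_add [symmetric] powr_minus_divide)
  finally have sq: "(\<integral>x. (norm (a x))\<^sup>2 \<partial>gauss) \<le> 1 / m"
    by (simp add: L2_norm_gauss_def)
  have "(\<integral>x. norm (a x) \<partial>gauss)
      \<le> (\<integral>x. m / 2 * (norm (a x))\<^sup>2 + 1 / (2 * m) * indicator (cball c r) x \<partial>gauss)"
  proof (rule integral_mono_AE)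
    show "AE x in gauss. norm (a x)
        \<le> m / 2 * (norm (a x))\<^sup>2 + 1 / (2 * m) * indicator (cball c r) x"
      using supp unfolding supported_in_def
    proof eventually_elim
      fix x assume *: "x \<notin> cball c r \<longrightarrow> a x = 0"
      have "0 \<le> (m * norm (a x) - 1)\<^sup>2 / (2 * m)"
        using m by simp
      also have "\<dots> = m / 2 * (norm (a x))\<^sup>2 + 1 / (2 * m) - norm (a x)"
        using m by (simp add: field_simps power2_eq_square)
      finally show "norm (a x) \<le> m / 2 * (norm (a x))\<^sup>2 + 1 / (2 * m) * indicator (cball c r) x"
        using * m by (auto simp: indicator_def)
    qed
  qed (use int in \<open>auto simp: gauss.emeasure_eq_measure\<close>)
  also have "\<dots> = m / 2 * (\<integral>x. (norm (a x))\<^sup>2 \<partial>gauss) + 1 / 2"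
    using int m by (subst Bochner_Integration.integral_add) (auto simp: m_def gauss.emeasure_eq_measure)
  also have "\<dots> \<le> m / 2 * (1 / m) + 1 / 2"
    using sq m by (intro add_mono mult_left_mono) auto
  also have "\<dots> = 1"
    using m by simp
  finally show ?thesis .
qed

text \<open>This is what truncation provides: the product of |x|^2 itself with an L^1 function may
  fail to be integrable.\<close>

lemma integrable_gauss_mult_bounded:
  fixes f :: "real^'n \<Rightarrow> 'k::{real_normed_field, banach, second_countable_topology}"
  assumes "integrable gauss f" "g \<in> borel_measurable borel" "\<And>x. \<bar>g x\<bar> \<le> M"
  shows "integrable gauss (\<lambda>x. of_real (g x) * f x)"
proof (rule Bochner_Integration.integrable_bound)
  show "integrable gauss (\<lambda>x. M * norm (f x))"
    using assms by simp
  have [measurable]: "f \<in> borel_measurable gauss"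
    using assms by auto
  note assms(2) [measurable]
  show "(\<lambda>x. of_real (g x) * f x) \<in> borel_measurable gauss"
    by measurable
  show "AE x in gauss. norm (of_real (g x) * f x) \<le> norm (M * norm (f x))"
  proof (rule AE_I2)
    fix x
    have "0 \<le> M"
      using assms(3) [of x] by linarith
    then show "norm (of_real (g x) * f x) \<le> norm (M * norm (f x))"
      using assms(3) [of x] by (auto simp: norm_mult abs_mult intro: mult_right_mono)
  qed
qed

lemma H1_atom_integrable:
  assumes "a \<in> H1_atoms"
  shows "integrable gauss a"
  using assms by (auto simp: H1_atoms_def L1_gauss_def)

text \<open>For an atom with vanishing integral, \<open>g\<close> may be replaced by
  \<open>g x - g c\<close> with \<open>c\<close> the centre of its ball; this is at most
  \<open>K\<close> there, and the atom has L^1 norm at most 1. The constant atom has no cancellation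
  and is covered by \<open>mean\<close>. The bound \<open>M\<close> serves integrability only and
  does not enter the estimate.\<close>

lemma H1_atom_pairing_le:
  fixes a :: "real^'n \<Rightarrow> 'k::{real_normed_field, banach, second_countable_topology}"
  assumes a: "a \<in> H1_atoms"
    and g [measurable]: "g \<in> borel_measurable borel" and M: "\<And>x. \<bar>g x\<bar> \<le> M"
    and osc: "\<And>c r x. r \<le> admissible_radius c \<Longrightarrow> x \<in> cball c r \<Longrightarrow> \<bar>g x - g c\<bar> \<le> K"
    and mean: "(\<integral>x. \<bar>g x\<bar> \<partial>gauss) \<le> K"
  shows "norm (\<integral>x. of_real (g x) * a x \<partial>gauss) \<le> K"
proof (cases "a = (\<lambda>x. 1)")
  case True
  have "norm (\<integral>x. of_real (g x) * a x \<partial>gauss) \<le> (\<integral>x. norm (of_real (g x) :: 'k) \<partial>gauss)"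
    unfolding True by (simp only: mult_1_right integral_norm_bound)
  with mean show ?thesis
    by simp
next
  case False
  with a obtain c r where r: "0 < r" "r \<le> admissible_radius c"
    and supp: "supported_in a (cball c r)"
    and L1: "a \<in> L1_gauss" and L2: "a \<in> L2_gauss"
    and nrm: "L2_norm_gauss a \<le> measure gauss (cball c r) powr (- 1 / 2)"
    and zero: "(\<integral>x. a x \<partial>gauss) = 0"
    by (auto simp: H1_atoms_def)
  have int: "integrable gauss a"
    using L1 by (simp add: L1_gauss_def)
  have K: "0 \<le> K"
    using order_trans [OF Bochner_Integration.integral_nonneg mean] by simp
  have "(\<integral>x. of_real (g x) * a x \<partial>gauss)
      = (\<integral>x. of_real (g x) * a x - of_real (g c) * a x \<partial>gauss)"
    using int integrable_gauss_mult_bounded [OF int g M] zero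
    by (subst Bochner_Integration.integral_diff) auto
  also have "norm \<dots> \<le> (\<integral>x. norm (of_real (g x) * a x - of_real (g c) * a x) \<partial>gauss)"
    by (rule integral_norm_bound)
  also have "\<dots> \<le> (\<integral>x. K * norm (a x) \<partial>gauss)"
  proof (rule integral_mono_AE)
    show "integrable gauss (\<lambda>x. norm (of_real (g x) * a x - of_real (g c) * a x))"
      using int integrable_gauss_mult_bounded [OF int g M] by auto
    show "AE x in gauss. norm (of_real (g x) * a x - of_real (g c) * a x) \<le> K * norm (a x)"
      using supp unfolding supported_in_def
    proof eventually_elim
      fix x assume *: "x \<notin> cball c r \<longrightarrow> a x = 0"
      have "norm (of_real (g x) * a x - of_real (g c) * a x) = \<bar>g x - g c\<bar> * norm (a x)"
        by (metis left_diff_distrib norm_mult norm_of_real of_real_diff)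
      also have "\<dots> \<le> K * norm (a x)"
        using * osc [OF r(2)] by (cases "x \<in> cball c r") (auto intro: mult_right_mono)
      finally show "norm (of_real (g x) * a x - of_real (g c) * a x) \<le> K * norm (a x)" .
    qed
  qed (use int in auto)
  also have "\<dots> \<le> K * 1"
    using L1_norm_le_one [OF L1 L2 r(1) supp nrm] K by (simp add: mult_left_le)
  finally show ?thesis
    by simp
qed

text \<open>Pairing with a bounded function is continuous on L^1, so the bound for partial sums
  passes to the limit. The size \<open>M\<close> of \<open>g\<close> multiplies only the remainder,
  which tends to 0, and so is absent from the conclusion.\<close>

lemma atomic_pairing_le:
  fixes f :: "real^'n \<Rightarrow> 'k::{real_normed_field, banach, second_countable_topology}"
    and l :: "nat \<Rightarrow> 'k"
  assumes f: "integrable gauss f" and a: "\<And>j. integrable gauss (a j)"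
    and l: "summable (\<lambda>j. norm (l j))"
    and lim: "(\<lambda>N. \<integral>x. norm (f x - (\<Sum>j<N. l j * a j x)) \<partial>gauss) \<longlonglongrightarrow> 0"
    and g: "g \<in> borel_measurable borel" and M: "\<And>x. \<bar>g x\<bar> \<le> M"
    and K: "\<And>j. norm (\<integral>x. of_real (g x) * a j x \<partial>gauss) \<le> K"
  shows "norm (\<integral>x. of_real (g x) * f x \<partial>gauss) \<le> K * (\<Sum>j. norm (l j))"
proof -
  define S where "S N x = (\<Sum>j<N. l j * a j x)" for N x
  have S: "integrable gauss (S N)" for N
    unfolding S_def by (intro Bochner_Integration.integrable_sum integrable_mult_right a)
  note gint = integrable_gauss_mult_bounded [OF _ g M]
  have M0: "0 \<le> M"
    \<comment> \<open>Any point would do: \<open>M\<close> dominates an absolute value.\<close>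
    using M [of undefined] by linarith
  have K0: "0 \<le> K"
    using order_trans [OF norm_ge_zero K] .
  have pS: "norm (\<integral>x. of_real (g x) * S N x \<partial>gauss) \<le> K * (\<Sum>j. norm (l j))" for N
  proof -
    have "(\<integral>x. of_real (g x) * S N x \<partial>gauss) = (\<integral>x. (\<Sum>j<N. l j * (of_real (g x) * a j x)) \<partial>gauss)"
      by (simp add: S_def sum_distrib_left algebra_simps)
    also have "\<dots> = (\<Sum>j<N. l j * (\<integral>x. of_real (g x) * a j x \<partial>gauss))"
      using gint [OF a] by (subst Bochner_Integration.integral_sum) auto
    also have "norm \<dots> \<le> (\<Sum>j<N. norm (l j) * K)"
      by (intro sum_norm_le) (auto simp: norm_mult K intro: mult_left_mono)
    also have "\<dots> = K * (\<Sum>j<N. norm (l j))"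
      by (simp add: sum_distrib_left mult.commute)
    also have "\<dots> \<le> K * (\<Sum>j. norm (l j))"
      using l K0 by (intro mult_left_mono sum_le_suminf) auto
    finally show ?thesis .
  qed
  have diff: "norm (\<integral>x. of_real (g x) * f x \<partial>gauss)
      \<le> M * (\<integral>x. norm (f x - S N x) \<partial>gauss) + K * (\<Sum>j. norm (l j))" for N
  proof -
    have d: "integrable gauss (\<lambda>x. f x - S N x)"
      using f S by simp
    have "(\<integral>x. of_real (g x) * f x \<partial>gauss)
        = (\<integral>x. of_real (g x) * (f x - S N x) \<partial>gauss) + (\<integral>x. of_real (g x) * S N x \<partial>gauss)"
      using gint [OF d] gint [OF S]
      by (subst Bochner_Integration.integral_add [symmetric]) (auto simp: algebra_simps)
    then have "norm (\<integral>x. of_real (g x) * f x \<partial>gauss)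
        \<le> norm (\<integral>x. of_real (g x) * (f x - S N x) \<partial>gauss) + K * (\<Sum>j. norm (l j))"
      using pS [of N] by (simp only:) (rule norm_triangle_le, rule add_left_mono)
    moreover have "norm (\<integral>x. of_real (g x) * (f x - S N x) \<partial>gauss)
        \<le> (\<integral>x. norm (of_real (g x) * (f x - S N x)) \<partial>gauss)"
      by (rule integral_norm_bound)
    moreover have "\<dots> \<le> (\<integral>x. M * norm (f x - S N x) \<partial>gauss)"
      using gint [OF d] d
      by (intro integral_mono integrable_norm integrable_mult_right)
        (auto simp: norm_mult M intro: mult_right_mono)
    moreover have "\<dots> = M * (\<integral>x. norm (f x - S N x) \<partial>gauss)"
      by (rule integral_mult_right_zero)
    ultimately show ?thesis
      by linarith
  qed
  have "(\<lambda>N. M * (\<integral>x. norm (f x - S N x) \<partial>gauss) + K * (\<Sum>j. norm (l j)))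
      \<longlonglongrightarrow> M * 0 + K * (\<Sum>j. norm (l j))"
    using lim unfolding S_def by (intro tendsto_intros)
  then show ?thesis
    using diff by (intro LIMSEQ_le_const [of _ "K * (\<Sum>j. norm (l j))"]) auto
qed

text \<open>One decomposition of \<open>f\<close> is fixed before the truncation level is chosen,
  and the constant for atoms does not depend on that level. Hence a single \<open>C\<close> serves
  all \<open>M\<close>.\<close>

lemma H1_gauss_truncated_pairing_bounded:
  fixes f :: "real^'n \<Rightarrow> 'k::{real_normed_field, banach, second_countable_topology}"
  assumes "f \<in> H1_gauss"
  obtains C where "\<And>M. 0 \<le> M \<Longrightarrow>
    norm (\<integral>x. of_real (min ((norm x)\<^sup>2) M) * f x \<partial>gauss) \<le> C"
proof -
  obtain l :: "nat \<Rightarrow> 'k" and a where f: "integrable gauss f" and a: "\<And>j. a j \<in> H1_atoms"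
    and l: "summable (\<lambda>j. norm (l j))"
    and lim: "(\<lambda>N. \<integral>x. norm (f x - (\<Sum>j<N. l j * a j x)) \<partial>gauss) \<longlonglongrightarrow> 0"
    using assms by (auto simp: H1_gauss_def atomic_space_def L1_gauss_def)
  \<comment> \<open>The entry 3 is the oscillation bound for atoms with vanishing integral; the
    second moment handles the constant atom.\<close>
  define K where "K = max 3 (\<integral>x. (norm (x::real^'n))\<^sup>2 \<partial>gauss)"
  have "norm (\<integral>x. of_real (min ((norm x)\<^sup>2) M) * f x \<partial>gauss) \<le> K * (\<Sum>j. norm (l j))"
    if "0 \<le> M" for M
  proof (rule atomic_pairing_le [OF f H1_atom_integrable [OF a] l lim])
    show "(\<lambda>x::real^'n. min ((norm x)\<^sup>2) M) \<in> borel_measurable borel"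
      by measurable
    show "\<bar>min ((norm x)\<^sup>2) M\<bar> \<le> M" for x :: "real^'n"
      using that by (auto simp: min_def)
    show "norm (\<integral>x. of_real (min ((norm x)\<^sup>2) M) * a j x \<partial>gauss) \<le> K" for j
    proof (rule H1_atom_pairing_le [OF a])
      show "(\<lambda>x::real^'n. min ((norm x)\<^sup>2) M) \<in> borel_measurable borel"
        by measurable
      show "\<bar>min ((norm x)\<^sup>2) M\<bar> \<le> M" for x :: "real^'n"
        using that by (auto simp: min_def)
      \<comment> \<open>Truncation at \<open>M\<close> is a 1-Lipschitz map, so it does not increase
        the oscillation.\<close>
      show "\<bar>min ((norm x)\<^sup>2) M - min ((norm c)\<^sup>2) M\<bar> \<le> K"
        if "r \<le> admissible_radius c" "x \<in> cball c r" for c x :: "real^'n" and r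
        using norm_sq_oscillation [OF that] by (auto simp: K_def min_def)
      have "(\<integral>x. \<bar>min ((norm (x::real^'n))\<^sup>2) M\<bar> \<partial>gauss) \<le> (\<integral>x. (norm (x::real^'n))\<^sup>2 \<partial>gauss)"
        using that by (intro integral_mono' integrable_gauss_norm_sq) auto
      then show "(\<integral>x. \<bar>min ((norm (x::real^'n))\<^sup>2) M\<bar> \<partial>gauss) \<le> K"
        by (simp add: K_def)
    qed
  qed
  then show ?thesis
    by (rule that)
qed

section \<open>A series of global atoms with unbounded pairings\<close>

text \<open>The squared L^2 norm is m/m^2 = 1/m with m the measure of the ball, so the size
  condition holds with equality.\<close>

lemma normalized_indicator_global_atom:
  fixes c :: "real^'n"
  defines "B \<equiv> cball c (admissible_radius c)"
  shows "(\<lambda>x. of_real (indicator B x / measure gauss B)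
    :: 'k::{real_normed_field, banach, second_countable_topology}) \<in> global_atoms"
proof -
  define m where "m = measure gauss B"
  have m: "0 < m"
    unfolding m_def B_def by (rule measure_gauss_cball_pos [OF admissible_radius_pos])
  have [measurable]: "B \<in> sets borel"
    by (simp add: B_def)
  have sq: "(norm (of_real (indicator B x / m) :: 'k))\<^sup>2 = indicator B x / m\<^sup>2" for x
    by (auto simp: indicator_def power_divide norm_divide simp flip: of_real_divide)
  have "L2_norm_gauss (\<lambda>x. of_real (indicator B x / m) :: 'k) = sqrt (1 / m)"
    using m unfolding L2_norm_gauss_def sq by (simp add: m_def [symmetric] power2_eq_square)
  also have "\<dots> = m powr (- 1 / 2)"
    using m by (simp add: powr_minus_divide powr_half_sqrt real_sqrt_divide)
  finally have "L2_norm_gauss (\<lambda>x. of_real (indicator B x / m) :: 'k) = m powr (- 1 / 2)" .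
  moreover have "(\<lambda>x. of_real (indicator B x / m) :: 'k) \<in> L2_gauss"
    unfolding L2_gauss_def mem_Collect_eq sq
    by (auto simp: gauss.emeasure_eq_measure intro!: borel_measurable_of_real)
  ultimately show ?thesis
    unfolding global_atoms_def m_def [symmetric] B_def [symmetric]
    by (auto simp: supported_in_def intro!: exI [of _ c] AE_I2) (auto simp: B_def m_def)
qed

text \<open>Truncating |x|^2 at 4^J, each of the first J terms of the series contributes at least
  2^-j 4^j = 2^j \<ge> 1 to the pairing, and all other contributions are nonnegative. The function
  is built with real values, where monotonicity is available, and then embedded by
  \<open>of_real\<close>.\<close>

lemma h1_gauss_truncated_pairing_unbounded:
  obtains f :: "real^'n \<Rightarrow> 'k::{real_normed_field, banach, second_countable_topology}"
  where "f \<in> h1_gauss"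
    and "\<And>J::nat. \<exists>M\<ge>0. real J \<le> norm (\<integral>x. of_real (min ((norm x)\<^sup>2) M) * f x \<partial>gauss)"
proof -
  obtain u :: "real^'n" where u: "norm u = 1"
    using vector_choose_size [of 1] by auto
  \<comment> \<open>Admissible radii are at most 1, so the extra 1 in |c j| keeps the whole ball at
    distance at least 2^j from the origin.\<close>
  define c where "c j = (2 ^ j + 1) *\<^sub>R u" for j :: nat
  define B where "B j = cball (c j) (admissible_radius (c j))" for j
  define b where "b j x = indicator (B j) x / measure gauss (B j)" for j x
  define f where "f x = (\<Sum>j. (1/2) ^ j * b j x)" for x
  have mpos: "0 < measure gauss (B j)" for j
    unfolding B_def by (rule measure_gauss_cball_pos [OF admissible_radius_pos])
  have [measurable]: "B j \<in> sets borel" for j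
    by (simp add: B_def)
  have b0: "0 \<le> b j x" for j x
    by (simp add: b_def)
  have bint: "integrable gauss (b j)" for j
    unfolding b_def by (simp add: gauss.emeasure_eq_measure)
  have b1: "(\<integral>x. b j x \<partial>gauss) = 1" for j
    using mpos [of j] by (simp add: b_def)
  have far: "2 ^ j \<le> norm x" if "x \<in> B j" for j x
  proof -
    have "norm (c j) = 2 ^ j + 1"
      by (simp add: c_def u)
    moreover have "norm (c j - x) \<le> 1"
      using that admissible_radius_le_one [of "c j"] by (simp add: B_def dist_norm)
    ultimately show ?thesis
      using norm_triangle_ineq2 [of "c j" x] by linarith
  qed
  \<comment> \<open>A point of \<open>B j\<close> satisfies j < 2^j \<le> |x|, so only finitely many
    terms are nonzero at each x. The series thus converges at every point.\<close>
  have fin: "finite {j. (1/2) ^ j * b j x \<noteq> 0}" for x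
  proof -
    have "j < nat \<lceil>norm x\<rceil>" if "x \<in> B j" for j
    proof -
      have "real j < 2 ^ j"
        by (rule of_nat_less_two_power)
      then show ?thesis
        using far [OF that] by linarith
    qed
    then have "{j. (1/2) ^ j * b j x \<noteq> 0} \<subseteq> {..< nat \<lceil>norm x\<rceil>}"
      by (auto simp: b_def indicator_def split: if_splits)
    then show ?thesis
      using finite_subset by blast
  qed
  then have sm: "summable (\<lambda>j. (1/2) ^ j * b j x)" for x
    by (intro summable_finite [OF fin]) auto
  have fsum: "(\<Sum>j<N. (1/2) ^ j * b j x) \<le> f x" for N x
    unfolding f_def by (intro sum_le_suminf sm) (auto simp: b0)
  have fint: "integrable gauss f"
    unfolding f_def
  proof (rule integrable_suminf)
    show "integrable gauss (\<lambda>x. (1/2) ^ j * b j x)" for j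
      using bint by simp
    show "AE x in gauss. summable (\<lambda>j. norm ((1/2) ^ j * b j x))"
      using sm b0 by (simp add: abs_mult)
    show "summable (\<lambda>j. \<integral>x. norm ((1/2) ^ j * b j x) \<partial>gauss)"
      using b0 b1 by (simp add: abs_mult summable_geometric)
  qed
  have "(\<lambda>x. of_real (f x) :: 'k) \<in> h1_gauss"
    unfolding h1_gauss_def atomic_space_def mem_Collect_eq
  proof (intro conjI exI allI)
    show "(\<lambda>x. of_real (f x) :: 'k) \<in> L1_gauss"
      using fint by (simp add: L1_gauss_def)
    show "(\<lambda>x. of_real (b j x) :: 'k) \<in> h1_atoms" for j
      unfolding h1_atoms_def b_def B_def using normalized_indicator_global_atom by blast
    show "summable (\<lambda>j. norm (of_real ((1/2) ^ j) :: 'k))"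
      unfolding norm_of_real by (simp add: summable_geometric power_abs)
    \<comment> \<open>The terms are nonnegative, so each remainder lies between 0 and
      \<open>f\<close> and equals the norm of its image under \<open>of_real\<close>. Dominated
      convergence with majorant \<open>f\<close> therefore gives the L^1 convergence
      required.\<close>
    have "(\<lambda>N. \<integral>x. f x - (\<Sum>j<N. (1/2) ^ j * b j x) \<partial>gauss) \<longlonglongrightarrow> integral\<^sup>L (gauss :: (real^'n) measure) (\<lambda>x. 0)"
    proof (rule integral_dominated_convergence [where w = f])
      show "AE x in gauss. (\<lambda>N. f x - (\<Sum>j<N. (1/2) ^ j * b j x)) \<longlonglongrightarrow> 0"
      proof (rule AE_I2)
        fix x
        have "(\<lambda>N. f x - (\<Sum>j<N. (1/2) ^ j * b j x)) \<longlonglongrightarrow> f x - f x"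
          unfolding f_def by (intro tendsto_intros summable_LIMSEQ sm)
        then show "(\<lambda>N. f x - (\<Sum>j<N. (1/2) ^ j * b j x)) \<longlonglongrightarrow> 0"
          by simp
      qed
      show "AE x in gauss. norm (f x - (\<Sum>j<N. (1/2) ^ j * b j x)) \<le> f x" for N
        using fsum by (auto simp: abs_le_iff intro!: sum_nonneg mult_nonneg_nonneg b0)
    qed (use fint bint in auto)
    moreover have "norm (of_real (f x) - (\<Sum>j<N. of_real ((1/2) ^ j) * of_real (b j x)) :: 'k)
        = f x - (\<Sum>j<N. (1/2) ^ j * b j x)" for N x
    proof -
      have "(of_real (f x) - (\<Sum>j<N. of_real ((1/2) ^ j) * of_real (b j x)) :: 'k)
          = of_real (f x - (\<Sum>j<N. (1/2) ^ j * b j x))"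
        by (simp only: of_real_diff of_real_sum of_real_mult)
      then show ?thesis
        using fsum [of x N] by (simp only: norm_of_real)
    qed
    ultimately show "(\<lambda>N. \<integral>x. norm (of_real (f x)
        - (\<Sum>j<N. of_real ((1/2) ^ j) * of_real (b j x)) :: 'k) \<partial>gauss) \<longlonglongrightarrow> 0"
      by (simp only: Bochner_Integration.integral_zero)
  qed
  moreover have "\<exists>M\<ge>0. real J
      \<le> norm (\<integral>x. of_real (min ((norm x)\<^sup>2) M) * (of_real (f x) :: 'k) \<partial>gauss)" for J :: nat
  proof (intro exI conjI)
    \<comment> \<open>The level 4^J lies above 4^j for every j < J, so truncation preserves the
      lower bound 4^j on each of the balls used.\<close>
    let ?g = "\<lambda>x::real^'n. min ((norm x)\<^sup>2) (4 ^ J)"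
    have gint: "integrable gauss (\<lambda>x. ?g x * h x)" if "integrable gauss h" for h :: "real^'n \<Rightarrow> real"
      using integrable_gauss_mult_bounded [OF that, of ?g "4 ^ J"] by simp
    have four: "(4::real) ^ j = (2 ^ j)\<^sup>2" for j
      using power_mult [of "2::real" 2 j] power_mult [of "2::real" j 2] by (simp add: mult.commute)
    have "real J = (\<Sum>j<J. 1)"
      by simp
    also have "\<dots> \<le> (\<Sum>j<J. (1/2) ^ j * 4 ^ j)"
      by (intro sum_mono) (simp add: power_mult_distrib [symmetric])
    also have "\<dots> = (\<Sum>j<J. \<integral>x. (1/2) ^ j * 4 ^ j * b j x \<partial>gauss)"
      by (simp add: b1)
    also have "\<dots> = (\<integral>x. (\<Sum>j<J. (1/2) ^ j * 4 ^ j * b j x) \<partial>gauss)"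
      using bint by (intro Bochner_Integration.integral_sum [symmetric]) simp
    also have "\<dots> \<le> (\<integral>x. ?g x * f x \<partial>gauss)"
    proof (rule integral_mono)
      fix x
      have "4 ^ j * b j x \<le> ?g x * b j x" if "j < J" for j
      proof (cases "x \<in> B j")
        case True
        then have "(4::real) ^ j \<le> (norm x)\<^sup>2"
          unfolding four by (intro power_mono far) auto
        then show ?thesis
          using that by (intro mult_right_mono b0) (auto intro: power_increasing)
      qed (simp add: b_def)
      then have "(\<Sum>j<J. (1/2) ^ j * (4 ^ j * b j x)) \<le> (\<Sum>j<J. (1/2) ^ j * (?g x * b j x))"
        by (intro sum_mono mult_left_mono) auto
      also have "\<dots> = ?g x * (\<Sum>j<J. (1/2) ^ j * b j x)"
        by (simp only: sum_distrib_left mult.left_commute)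
      also have "\<dots> \<le> ?g x * f x"
        by (intro mult_left_mono fsum) auto
      finally show "(\<Sum>j<J. (1/2) ^ j * 4 ^ j * b j x) \<le> ?g x * f x"
        by (simp only: mult.assoc)
    qed (use bint gint [OF fint] in auto)
    also have "\<dots> \<le> norm (of_real (\<integral>x. ?g x * f x \<partial>gauss) :: 'k)"
      by simp
    also have "of_real (\<integral>x. ?g x * f x \<partial>gauss)
        = (\<integral>x. of_real (?g x) * (of_real (f x) :: 'k) \<partial>gauss)"
      unfolding of_real_mult [symmetric] by (rule integral_of_real [symmetric]) (rule gint [OF fint])
    finally show "real J \<le> norm (\<integral>x. of_real (?g x) * (of_real (f x) :: 'k) \<partial>gauss)" .
  qed simp
  ultimately show ?thesis
    by (rule that)
qed

section \<open>Strictness of the inclusion\<close>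

theorem proposition2p4:
  shows "(H1_gauss ::
      (real ^ 'n \<Rightarrow> 'k::{real_normed_field, banach, second_countable_topology}) set)
    \<subset> h1_gauss"
proof
  show "(H1_gauss :: (real^'n \<Rightarrow> 'k) set) \<subseteq> h1_gauss"
    unfolding H1_gauss_def h1_gauss_def atomic_space_def h1_atoms_def by blast
  obtain f :: "real^'n \<Rightarrow> 'k" where f: "f \<in> h1_gauss"
    and unbdd: "\<And>J::nat. \<exists>M\<ge>0.
      real J \<le> norm (\<integral>x. of_real (min ((norm x)\<^sup>2) M) * f x \<partial>gauss)"
    using h1_gauss_truncated_pairing_unbounded by blast
  have "f \<notin> H1_gauss"
  proof
    assume "f \<in> H1_gauss"
    then obtain C where C: "\<And>M. 0 \<le> M \<Longrightarrow>
        norm (\<integral>x. of_real (min ((norm x)\<^sup>2) M) * f x \<partial>gauss) \<le> C"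
      using H1_gauss_truncated_pairing_bounded by blast
    obtain J :: nat where "C < real J"
      using reals_Archimedean2 by blast
    then show False
      using C unbdd [of J] by fastforce
  qed
  with f show "(H1_gauss :: (real^'n \<Rightarrow> 'k) set) \<noteq> h1_gauss"
    by blast
qed

end
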